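(* Let $m\ge 2$ and $n\ge 3$. Then: $\mathrm{f}\mu^{k}(P_m\,\square\,C_n)=3$ if $k\ge 1$ and $n=3$; $\mathrm{f}\mu^{k}(P_m\,\square\,C_n)=\min\{2m,n\}$ if $k=1$ and $n\ge 4$ is even; $\mathrm{f}\mu^{k}(P_m\,\square\,C_n)=\max\{3,\min\{m,n\}\}$ if $k=1$ and $n\ge 5$ is odd; $\mathrm{f}\mu^{k}(P_m\,\square\,C_n)=2$ if $k\ge 2$ and $n\ge 4$.
   Context: For an integer $k\ge 0$ and a connected graph $G$, a set $X\subseteq V(G)$ is a $k$-fault-tolerant mutual-visibility set ($k$-ftmv set) if for any two non-adjacent vertices $u,v\in X$ there exist $k+1$ internally vertex-disjoint shortest $u,v$-paths $Q_1,\dots,Q_{k+1}$ in $G$ such that $V(Q_i)\cap X=\{u,v\}$ for every $i$. $\mathrm{f}\mu^{k}(G)$ denotes the maximum cardinality of a $k$-ftmv set of $G$. $P_m$ is the path on $m$ vertices, $C_n$ the cycle on $n$ vertices, and $G\,\square\,H$ is the Cartesian product: vertex set $V(G)\times V(H)$, with $(g,h)\sim(g',h')$ iff either $g=g'$ and $hh'\in E(H)$, or $gg'\in E(G)$ and $h=h'$. *)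

theory Defs
  imports "Graph_Theory.Graph_Theory"
begin

text \<open>
  Finite simple graphs are the symmetric loop-free pair digraphs of \<^locale>\<open>pair_graph\<close>: an
  undirected edge is represented by its two opposite arcs. Paths are the vertex lists
  \<^const>\<open>vpath\<close>; a path with list length \<open>l + 1\<close> has \<open>l\<close> edges.
\<close>

definition path_graph :: "nat \<Rightarrow> nat pair_pre_digraph" where
  "path_graph m = \<lparr> pverts = {0..<m},
     parcs = {(i, j). i < m \<and> j < m \<and> (j = Suc i \<or> i = Suc j)} \<rparr>"

text \<open>The cycle is a simple graph only for \<open>n \<ge> 3\<close>; it has a loop for \<open>n = 1\<close>.\<close>

definition cycle_graph :: "nat \<Rightarrow> nat pair_pre_digraph" where
  "cycle_graph n = \<lparr> pverts = {0..<n},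
     parcs = {(i, j). i < n \<and> j < n \<and> (j = Suc i mod n \<or> i = Suc j mod n)} \<rparr>"

definition cartesian_product ::
  "'a pair_pre_digraph \<Rightarrow> 'b pair_pre_digraph \<Rightarrow> ('a \<times> 'b) pair_pre_digraph" (infixr \<open>\<box>\<close> 75)
where
  "G \<box> H = \<lparr> pverts = pverts G \<times> pverts H,
     parcs = {((g, h), (g', h')).
       g \<in> pverts G \<and> g = g' \<and> (h, h') \<in> parcs H \<or>
       (g, g') \<in> parcs G \<and> h \<in> pverts H \<and> h = h'} \<rparr>"

definition uv_path :: "'a pair_pre_digraph \<Rightarrow> 'a \<Rightarrow> 'a \<Rightarrow> 'a list \<Rightarrow> bool" where
  "uv_path G u v p \<longleftrightarrow> vpath p (with_proj G) \<and> hd p = u \<and> last p = v"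

definition shortest_uv_path :: "'a pair_pre_digraph \<Rightarrow> 'a \<Rightarrow> 'a \<Rightarrow> 'a list \<Rightarrow> bool" where
  "shortest_uv_path G u v p \<longleftrightarrow>
     uv_path G u v p \<and> (\<forall>q. uv_path G u v q \<longrightarrow> vwalk_length p \<le> vwalk_length q)"

text \<open>
  Since \<open>u\<close> and \<open>v\<close> are distinct and non-adjacent below, every \<open>u,v\<close>-path has an internal
  vertex, so internally disjoint paths with different indices are different.
\<close>

definition ftmv_set :: "nat \<Rightarrow> 'a pair_pre_digraph \<Rightarrow> 'a set \<Rightarrow> bool" where
  "ftmv_set k G X \<longleftrightarrow> X \<subseteq> pverts G \<and>
     (\<forall>u\<in>X. \<forall>v\<in>X. u \<noteq> v \<longrightarrow> (u, v) \<notin> parcs G \<longrightarrow>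
       (\<exists>Q :: nat \<Rightarrow> 'a list.
         (\<forall>i\<in>{1..k+1}. shortest_uv_path G u v (Q i) \<and> set (Q i) \<inter> X = {u, v}) \<and>
         (\<forall>i\<in>{1..k+1}. \<forall>j\<in>{1..k+1}. i \<noteq> j \<longrightarrow>
            (set (Q i) - {u, v}) \<inter> (set (Q j) - {u, v}) = {})))"

definition ftmv_number :: "nat \<Rightarrow> 'a pair_pre_digraph \<Rightarrow> nat" (\<open>f\<mu>\<close>) where
  "f\<mu> k G = Max {card X | X. ftmv_set k G X}"

lemma Max_ftmv_wf:
  assumes "finite (pverts G)"
  shows "finite {card X | X. ftmv_set k G X}" "{card X | X. ftmv_set k G X} \<noteq> {}"
proof -
  have "{card X | X. ftmv_set k G X} \<subseteq> card ` Pow (pverts G)"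
    by (auto simp: ftmv_set_def)
  with assms show "finite {card X | X. ftmv_set k G X}"
    using finite_subset by blast
  have "ftmv_set k G {}" by (simp add: ftmv_set_def)
  then show "{card X | X. ftmv_set k G X} \<noteq> {}" by blast
qed

lemma pair_graph_path: "pair_graph (path_graph m)"
proof
  show "finite (parcs (path_graph m))"
    by (rule finite_subset[of _ "{0..<m} \<times> {0..<m}"]) (auto simp: path_graph_def)
qed (auto simp: path_graph_def symmetric_def sym_def)

lemma pair_graph_cycle:
  assumes "n \<ge> 3"
  shows "pair_graph (cycle_graph n)"
proof
  show "finite (parcs (cycle_graph n))"
    by (rule finite_subset[of _ "{0..<n} \<times> {0..<n}"]) (auto simp: cycle_graph_def)
  show "fst e \<noteq> snd e" if "e \<in> parcs (cycle_graph n)" for e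
    using that assms by (auto simp: cycle_graph_def mod_Suc split: if_splits)
qed (auto simp: cycle_graph_def symmetric_def sym_def)

lemma pair_graph_cartesian_product:
  assumes "pair_graph G" "pair_graph H"
  shows "pair_graph (G \<box> H)"
proof -
  interpret G: pair_graph G by fact
  interpret H: pair_graph H by fact
  have symG: "(y, x) \<in> parcs G" if "(x, y) \<in> parcs G" for x y
    using G.pair_sym_arcs that by (auto simp: symmetric_def sym_def)
  have symH: "(y, x) \<in> parcs H" if "(x, y) \<in> parcs H" for x y
    using H.pair_sym_arcs that by (auto simp: symmetric_def sym_def)
  have fin: "finite (pverts (G \<box> H))"
    by (simp add: cartesian_product_def G.pair_finite_verts H.pair_finite_verts)
  have sub: "parcs (G \<box> H) \<subseteq> pverts (G \<box> H) \<times> pverts (G \<box> H)"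
    by (auto simp: cartesian_product_def dest: G.wellformed' H.wellformed')
  show ?thesis
  proof
    show "finite (parcs (G \<box> H))" using finite_subset[OF sub] fin by blast
    show "fst e \<noteq> snd e" if "e \<in> parcs (G \<box> H)" for e
      using that by (auto simp: cartesian_product_def dest: G.pair_no_loops H.pair_no_loops)
    show "symmetric (with_proj (G \<box> H))"
      by (auto simp: symmetric_def sym_def cartesian_product_def intro: symG symH)
  qed (use fin sub in auto)
qed

lemma connected_path_cycle_product:
  assumes m: "m \<ge> 2" and n: "n \<ge> 3"
  shows "connected (with_proj (path_graph m \<box> cycle_graph n))"
proof -
  let ?G = "path_graph m \<box> cycle_graph n"
  interpret pair_graph ?G
    by (intro pair_graph_cartesian_product pair_graph_path pair_graph_cycle n)
  have col: "(0, 0) \<rightarrow>\<^sup>*\<^bsub>with_proj ?G\<^esub> (0, j)" if "j < n" for j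
    using that
  proof (induction j)
    case 0
    then show ?case
      using m by (intro reachable_refl) (auto simp: cartesian_product_def path_graph_def cycle_graph_def)
  next
    case (Suc j)
    then have "(0, j) \<rightarrow>\<^bsub>with_proj ?G\<^esub> (0, Suc j)"
      using m by (auto simp: cartesian_product_def path_graph_def cycle_graph_def)
    with Suc show ?case
      using wf_digraph.reachable_adj_trans[OF wf_digraph] by fastforce
  qed
  have row: "(0, 0) \<rightarrow>\<^sup>*\<^bsub>with_proj ?G\<^esub> (i, j)" if "i < m" "j < n" for i j
    using that
  proof (induction i)
    case 0
    then show ?case using col by blast
  next
    case (Suc i)
    then have "(i, j) \<rightarrow>\<^bsub>with_proj ?G\<^esub> (Suc i, j)"
      by (auto simp: cartesian_product_def path_graph_def cycle_graph_def)
    with Suc show ?case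
      using wf_digraph.reachable_adj_trans[OF wf_digraph] by fastforce
  qed
  have reach: "(0, 0) \<rightarrow>\<^sup>*\<^bsub>with_proj ?G\<^esub> x" if "x \<in> pverts ?G" for x
    using that row by (auto simp: cartesian_product_def path_graph_def cycle_graph_def)
  have nonempty: "(0, 0) \<in> pverts ?G"
    using m n by (auto simp: cartesian_product_def path_graph_def cycle_graph_def)
  show ?thesis
    unfolding connected_conv
  proof (intro conjI ballI)
    show "verts (with_proj ?G) \<noteq> {}" using nonempty by auto
    fix x y assume "x \<in> verts (with_proj ?G)" "y \<in> verts (with_proj ?G)"
    then have "x \<rightarrow>\<^sup>*\<^bsub>with_proj ?G\<^esub> (0, 0)" "(0, 0) \<rightarrow>\<^sup>*\<^bsub>with_proj ?G\<^esub> y"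
      using reach symmetric_reachable[OF pair_sym_arcs] by auto
    then have "x \<rightarrow>\<^sup>*\<^bsub>with_proj ?G\<^esub> y"
      by (rule wf_digraph.reachable_trans[OF wf_digraph])
    then show "(x, y) \<in> rtrancl_on (verts (with_proj ?G)) ((arcs_ends (with_proj ?G))\<^sup>s)"
      by (auto simp: reachable_def symcl_def intro: rtrancl_on_mono)
  qed
qed

end

theory Submission
  imports Defs
begin

text \<open>
  In the cylinder the distance of \<open>(i, a)\<close> and \<open>(j, b)\<close> is the sum of the distances in the path
  and in the cycle. The second vertices of \<open>k + 1\<close> internally disjoint shortest \<open>u,v\<close>-paths are
  distinct neighbours of \<open>u\<close> closer to \<open>v\<close>, and none of them lies in \<open>X\<close>. There are at most
  three such neighbours: one in the column of \<open>u\<close>, and one in its row, or two if the columns of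
  \<open>u\<close> and \<open>v\<close> are opposite on the cycle. Counting them gives every upper bound: a pair adjacent
  in a column or in a row confines \<open>X\<close> to very few columns, and without such pairs each column
  contains at most one vertex of \<open>X\<close> and each row at most two (opposite) ones.

  Conversely, for \<open>k = 1\<close> two vertices in distinct rows and columns are joined by the two paths
  along the boundary of the rectangle that they span, and opposite
  vertices of a row by the two halves of the row. These avoid the diagonal
  \<open>(t, t)\<close>, for even \<open>n\<close> even together with its opposite copy \<open>(t, t + n div 2)\<close>, and for odd
  \<open>n = 2 * h + 1\<close> the triple \<open>(0, 0), (0, 1), (1, h + 1)\<close>.
\<close>

section \<open>Walks confined to a vertex set\<close>

text \<open>Walks instead of paths, so that concatenation raises no question of distinctness; that
  is recovered once a walk has the length of the distance (\<open>vwalk_distinct\<close>). The set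
  \<open>S\<close> records where the walk runs, which later yields both avoidance of
  \<open>X\<close> and disjointness.\<close>

definition walk_in :: "'a pair_pre_digraph \<Rightarrow> 'a set \<Rightarrow> 'a \<Rightarrow> 'a \<Rightarrow> nat \<Rightarrow> bool" where
  "walk_in G S u v l \<longleftrightarrow> (\<exists>p. vwalk p (with_proj G) \<and> hd p = u \<and> last p = v \<and>
     length p = Suc l \<and> set p \<subseteq> S)"

lemma walk_in_refl: "u \<in> pverts G \<Longrightarrow> walk_in G {u} u u 0"
  unfolding walk_in_def by (intro exI[of _ "[u]"]) auto

lemma walk_in_mono: "walk_in G S u v l \<Longrightarrow> S \<subseteq> T \<Longrightarrow> walk_in G T u v l"
  unfolding walk_in_def by blast

lemma walk_in_step:
  assumes "(u, w) \<in> parcs G" "u \<in> pverts G" "walk_in G S w v l"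
  shows "walk_in G (insert u S) u v (Suc l)"
proof -
  obtain p where p: "vwalk p (with_proj G)" "hd p = w" "last p = v" "length p = Suc l" "set p \<subseteq> S"
    using assms(3) by (auto simp: walk_in_def)
  then have "vwalk (u # p) (with_proj G)"
    using assms(1,2) by (intro vwalk_consI) auto
  then show ?thesis
    unfolding walk_in_def using p by (intro exI[of _ "u # p"]) auto
qed

lemma walk_in_trans:
  assumes "walk_in G S u w l" "walk_in G T w v l'"
  shows "walk_in G (S \<union> T) u v (l + l')"
proof -
  obtain p where p: "vwalk p (with_proj G)" "hd p = u" "last p = w" "length p = Suc l" "set p \<subseteq> S"
    using assms(1) by (auto simp: walk_in_def)
  obtain q where q: "vwalk q (with_proj G)" "hd q = w" "last q = v" "length q = Suc l'" "set q \<subseteq> T"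
    using assms(2) by (auto simp: walk_in_def)
  have ne: "p \<noteq> []" "q \<noteq> []" using p q by auto
  then have join: "joinable p q" using p q by (auto simp: joinable_def)
  have "vwalk (vwalk_join p q) (with_proj G)"
    using p q join by (intro vwalk_joinI_vwalk) auto
  moreover have "hd (vwalk_join p q) = u" "last (vwalk_join p q) = v"
    using p q ne join by (auto simp: vwalk_join_hd vwalk_join_last)
  moreover have "length (vwalk_join p q) = Suc (l + l')" "set (vwalk_join p q) \<subseteq> S \<union> T"
    using p q ne by (auto simp: vwalk_join_def dest: list.set_sel(2))
  ultimately show ?thesis unfolding walk_in_def by blast
qed

section \<open>Distances on paths and cycles\<close>

definition ldist :: "nat \<Rightarrow> nat \<Rightarrow> nat" where
  "ldist i j = (if i \<le> j then j - i else i - j)"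

definition cdist :: "nat \<Rightarrow> nat \<Rightarrow> nat \<Rightarrow> nat" where
  "cdist n a b = min (ldist a b) (n - ldist a b)"

lemma ldist_triangle: "ldist i j \<le> ldist i k + ldist k j"
  by (auto simp: ldist_def)

lemma ldist_eq_0: "ldist i j = 0 \<longleftrightarrow> i = j"
  by (auto simp: ldist_def)

lemma ldist_step:
  assumes "ldist i j > 0"
  obtains i' where "i' \<le> max i j" "ldist i i' = 1" "ldist i' j + 1 = ldist i j"
proof -
  let ?i = "if i < j then i + 1 else i - 1"
  have "?i \<le> max i j \<and> ldist i ?i = 1 \<and> ldist ?i j + 1 = ldist i j"
    using assms by (auto simp: ldist_def split: if_splits)
  with that show ?thesis by blast
qed

text \<open>Only the neighbour of \<open>i\<close> on the side of \<open>j\<close> is nearer to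
  \<open>j\<close>.\<close>

lemma ldist_closer_unique:
  assumes "ldist i x = 1" "ldist x j + 1 = ldist i j" "ldist i y = 1" "ldist y j + 1 = ldist i j"
  shows "x = y"
  using assms by (cases "i \<le> j") (auto simp: ldist_def split: if_splits)

text \<open>For \<open>a, b < n\<close> this is \<open>(b - a) mod n\<close> over the integers, the
  number of steps from \<open>a\<close> to \<open>b\<close> in increasing direction. The case split
  avoids \<open>mod\<close> and leaves statements to linear arithmetic.\<close>

definition fwd :: "nat \<Rightarrow> nat \<Rightarrow> nat \<Rightarrow> nat" where
  "fwd n a b = (if a \<le> b then b - a else b + n - a)"

lemma cdist_fwd: "a < n \<Longrightarrow> b < n \<Longrightarrow> cdist n a b = min (fwd n a b) (n - fwd n a b)"
  by (auto simp: cdist_def ldist_def fwd_def)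

lemma fwd_less: "a < n \<Longrightarrow> b < n \<Longrightarrow> fwd n a b < n"
  by (auto simp: fwd_def)

lemma fwd_inj: "\<lbrakk>a < n; b < n; c < n; fwd n a b = fwd n a c\<rbrakk> \<Longrightarrow> b = c"
  by (auto simp: fwd_def split: if_splits)

lemma fwd_eq_0: "\<lbrakk>a < n; b < n\<rbrakk> \<Longrightarrow> fwd n a b = 0 \<longleftrightarrow> a = b"
  by (auto simp: fwd_def)

text \<open>A detour over \<open>c\<close> costs either nothing or one full turn.\<close>

lemma fwd_add:
  "\<lbrakk>a < n; b < n; c < n\<rbrakk> \<Longrightarrow> fwd n a b = fwd n a c + fwd n c b \<or> fwd n a b + n = fwd n a c + fwd n c b"
  by (auto simp: fwd_def)

lemma cdist_one_fwd:
  assumes "a < n" "c < n" "cdist n a c = 1"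
  shows "fwd n a c = 1 \<or> fwd n c a = 1"
  using assms by (auto simp: cdist_def ldist_def fwd_def split: if_splits)

lemma fwd_one:
  assumes "a < n" "b < n" "c < n" "fwd n a c = 1"
  shows "fwd n a b = fwd n c b + 1 \<or> fwd n a b = 0 \<and> fwd n c b + 1 = n"
  using fwd_add[OF assms(1-3)] fwd_less[OF assms(1,2)] fwd_less[OF assms(3,2)] assms(4)
  by linarith

lemma cdist_triangle:
  assumes "a < n" "b < n" "c < n"
  shows "cdist n a b \<le> cdist n a c + cdist n c b"
  using fwd_add[OF assms] fwd_less[OF assms(1,2)] fwd_less[OF assms(1,3)] fwd_less[OF assms(3,2)] assms
  by (auto simp: cdist_fwd)

lemma cdist_sym: "cdist n a b = cdist n b a"
  by (simp add: cdist_def ldist_def)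

lemma cdist_eq_0: "\<lbrakk>a < n; b < n\<rbrakk> \<Longrightarrow> cdist n a b = 0 \<longleftrightarrow> a = b"
  by (auto simp: cdist_def ldist_def min_def)

lemma cdist_le: "2 * cdist n a b \<le> n"
  by (auto simp: cdist_def min_def)

text \<open>A closer neighbour lies on the shorter arc: forwards if \<open>b\<close> is less than
  half a turn ahead, otherwise backwards. A backward step raises the forward distance by one modulo
  \<open>n\<close>; the value wraps to 0 when the step reaches \<open>b\<close>.\<close>

lemma cdist_closer_fwd:
  assumes "a < n" "b < n" "c < n" "cdist n a c = 1" "cdist n c b + 1 = cdist n a b" "2 * cdist n a b \<noteq> n"
  shows "fwd n c b + 1 = fwd n a b \<and> 2 * fwd n a b < n \<or> 2 * fwd n a b > n \<and>
    (fwd n c b = fwd n a b + 1 \<or> fwd n c b = 0 \<and> fwd n a b + 1 = n)"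
  using cdist_one_fwd[OF assms(1,3,4)]
proof
  assume "fwd n a c = 1"
  from fwd_one[OF assms(1-3) this] assms(5,6) fwd_less[OF assms(1,2)] fwd_less[OF assms(3,2)]
  show ?thesis unfolding cdist_fwd[OF assms(1,2)] cdist_fwd[OF assms(3,2)] min_def
    by (auto split: if_splits)
next
  assume "fwd n c a = 1"
  from fwd_one[OF assms(3,2,1) this] assms(5,6) fwd_less[OF assms(1,2)] fwd_less[OF assms(3,2)]
  show ?thesis unfolding cdist_fwd[OF assms(1,2)] cdist_fwd[OF assms(3,2)] min_def
    by (auto split: if_splits)
qed

lemma fwd_inj_left: "\<lbrakk>a < n; b < n; c < n; fwd n b a = fwd n c a\<rbrakk> \<Longrightarrow> b = c"
  by (auto simp: fwd_def split: if_splits)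

lemma cdist_closer_unique:
  assumes "a < n" "b < n" "x < n" "y < n" "2 * cdist n a b \<noteq> n"
    "cdist n a x = 1" "cdist n x b + 1 = cdist n a b"
    "cdist n a y = 1" "cdist n y b + 1 = cdist n a b"
  shows "x = y"
proof -
  have "fwd n x b = fwd n y b"
    using cdist_closer_fwd[OF assms(1,2,3,6,7,5)] cdist_closer_fwd[OF assms(1,2,4,8,9,5)]
      fwd_less[OF assms(3,2)] fwd_less[OF assms(4,2)]
    by linarith
  then show ?thesis using fwd_inj_left assms by blast
qed

lemma cdist_opposite_unique:
  assumes "a < n" "x < n" "y < n" "2 * cdist n a x = n" "2 * cdist n a y = n"
  shows "x = y"
proof (rule fwd_inj[OF assms(1-3)])
  show "fwd n a x = fwd n a y"
  using assms fwd_less[OF assms(1,2)] fwd_less[OF assms(1,3)]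
  by (auto simp: cdist_fwd min_def split: if_splits)
qed

text \<open>Forward distances from \<open>a\<close> and its successor \<open>b\<close> differ by
  one, so equal cyclic distances force \<open>fwd n a x = n - fwd n b x\<close>: \<open>x\<close> is
  the middle of the long arc between \<open>a\<close> and \<open>b\<close>.\<close>

lemma equidistant_aux:
  assumes "a < n" "b < n" "x < n" "odd n" "n > 1" "fwd n a b = 1" "cdist n a x = cdist n b x"
  shows "2 * fwd n a x = n + 1"
  using fwd_one[OF assms(1,3,2,6)] fwd_less[OF assms(1,3)] fwd_less[OF assms(2,3)] assms(4,5,7)
  unfolding cdist_fwd[OF assms(1,3)] cdist_fwd[OF assms(2,3)] min_def
  by (auto split: if_splits)

lemma cdist_equidistant_unique:
  assumes "a < n" "b < n" "x < n" "y < n" "odd n" "n > 1" "cdist n a b = 1"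
    "cdist n a x = cdist n b x" "cdist n a y = cdist n b y"
  shows "x = y"
  using cdist_one_fwd[OF assms(1,2,7)]
proof
  assume 1: "fwd n a b = 1"
  show ?thesis 
    using equidistant_aux[OF assms(1,2,3,5,6) 1 assms(8)] equidistant_aux[OF assms(1,2,4,5,6) 1 assms(9)]
    by (intro fwd_inj[OF assms(1,3,4)]) simp
next
  assume 1: "fwd n b a = 1"
  show ?thesis 
    using equidistant_aux[OF assms(2,1,3,5,6) 1] equidistant_aux[OF assms(2,1,4,5,6) 1] assms(8,9)
    by (intro fwd_inj[OF assms(2,3,4)]) simp
qed

text \<open>An even cycle is bipartite: the distances from the two ends of an edge to
  \<open>x\<close> have different parity.\<close>

lemma cdist_neq_even_aux:
  assumes "a < n" "b < n" "x < n" "even n" "fwd n a b = 1"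
  shows "cdist n a x \<noteq> cdist n b x"
  using fwd_one[OF assms(1,3,2,5)] fwd_less[OF assms(1,3)] fwd_less[OF assms(2,3)] assms(4)
  unfolding cdist_fwd[OF assms(1,3)] cdist_fwd[OF assms(2,3)] min_def
  by (auto split: if_splits elim!: evenE; presburger)

lemma cdist_no_triangle_aux:
  assumes "a < n" "b < n" "x < n" "n \<ge> 4" "fwd n a b = 1" "cdist n a x \<le> 1" "cdist n b x \<le> 1"
  shows "a = x \<or> b = x"
  using fwd_one[OF assms(1,3,2,5)] fwd_less[OF assms(1,3)] fwd_less[OF assms(2,3)] assms(4,6,7)
    fwd_eq_0[OF assms(1,3)] fwd_eq_0[OF assms(2,3)]
  unfolding cdist_fwd[OF assms(1,3)] cdist_fwd[OF assms(2,3)] min_def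
  by (auto split: if_splits)

lemma cdist_neq_even:
  assumes "a < n" "b < n" "x < n" "even n" "cdist n a b = 1"
  shows "cdist n a x \<noteq> cdist n b x"
  using cdist_one_fwd[OF assms(1,2,5)] cdist_neq_even_aux[OF assms(1-4)] cdist_neq_even_aux[OF assms(2,1,3,4)]
  by metis

lemma cdist_no_triangle:
  assumes "a < n" "b < n" "x < n" "n \<ge> 4" "cdist n a b = 1" "cdist n a x \<le> 1" "cdist n b x \<le> 1"
  shows "a = x \<or> b = x"
  using cdist_one_fwd[OF assms(1,2,5)] cdist_no_triangle_aux[OF assms(1-4) _ assms(6,7)]
    cdist_no_triangle_aux[OF assms(2,1,3,4) _ assms(7,6)]
  by metis

lemma ex_fwd_one:
  assumes "a < n" "n \<ge> 3"
  obtains s where "s < n" "fwd n a s = 1"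
proof
  let ?s = "if a + 1 < n then a + 1 else 0"
  show "?s < n" "fwd n a ?s = 1" using assms by (auto simp: fwd_def)
qed

lemma ex_fwd_one':
  assumes "a < n" "n \<ge> 3"
  obtains p where "p < n" "fwd n p a = 1"
proof
  let ?p = "if a = 0 then n - 1 else a - 1"
  show "?p < n" "fwd n ?p a = 1" using assms by (auto simp: fwd_def)
qed

lemma cdist_step:
  assumes "a < n" "b < n" "n \<ge> 3" "cdist n a b > 0"
  obtains c where "c < n" "cdist n a c = 1" "cdist n c b + 1 = cdist n a b"
proof (cases "2 * fwd n a b \<le> n")
  case True
  obtain s where s: "s < n" "fwd n a s = 1"
    using assms(1,3) by (rule ex_fwd_one)
  have "cdist n a s = 1" using assms(1,3) s by (auto simp: cdist_fwd)
  moreover have "cdist n s b + 1 = cdist n a b"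
    using fwd_one[OF assms(1,2) s] True assms fwd_less[OF s(1) assms(2)] s by (auto simp: cdist_fwd)
  ultimately show ?thesis using that s by blast
next
  case False
  obtain p where p: "p < n" "fwd n p a = 1"
    using assms(1,3) by (rule ex_fwd_one')
  have "cdist n a p = 1" using assms(1,3) p by (auto simp: cdist_fwd cdist_sym[of _ a])
  moreover have "cdist n p b + 1 = cdist n a b"
    using fwd_one[OF p(1) assms(2,1) p(2)] False assms fwd_less[OF p(1) assms(2)] p
    fwd_less[OF assms(1,2)] by (auto simp: cdist_fwd)
  ultimately show ?thesis using that p by blast
qed

text \<open>With \<open>b\<close> less than half a turn ahead, the forward arc is the only geodesic,
  so a vertex metrically between \<open>a\<close> and \<open>b\<close> lies on it.\<close>

lemma interval_fwd:
  assumes "a < n" "b < n" "c < n" "2 * fwd n a b < n" "cdist n a c + cdist n c b = cdist n a b"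
  shows "fwd n a c + fwd n c b = fwd n a b"
  using fwd_add[OF assms(1-3)] fwd_less[OF assms(1,2)] fwd_less[OF assms(1,3)] fwd_less[OF assms(3,2)]
    assms(4,5)
  unfolding cdist_fwd[OF assms(1,2)] cdist_fwd[OF assms(1,3)] cdist_fwd[OF assms(3,2)] min_def
  by (auto split: if_splits)

lemma fwd_swap: "\<lbrakk>a < n; b < n; a \<noteq> b\<rbrakk> \<Longrightarrow> fwd n a b + fwd n b a = n"
  by (auto simp: fwd_def)

section \<open>Counting principles\<close>

lemma ftmv_number_eqI:
  assumes "finite (pverts G)" "ftmv_set k G Y" "card Y = c"
    "\<And>X. ftmv_set k G X \<Longrightarrow> card X \<le> c"
  shows "f\<mu> k G = c"
  unfolding ftmv_number_def
  using assms Max_ftmv_wf(1)[OF assms(1), of k] by (intro Max_eqI) auto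

lemma card_le_1I:
  assumes "\<And>x y. x \<in> A \<Longrightarrow> y \<in> A \<Longrightarrow> x = y"
  shows "finite A \<and> card A \<le> 1"
proof (cases "A = {}")
  case False
  then obtain x where "A = {x}" using assms by blast
  then show ?thesis by simp
qed simp

lemma card_le_2_consecutive:
  assumes "finite R" "\<And>x y. x \<in> R \<Longrightarrow> y \<in> R \<Longrightarrow> ldist x y \<le> 1"
  shows "card R \<le> 2"
proof (cases "R = {}")
  case False
  then have "Min R \<in> R" using assms(1) by simp
  then have "R \<subseteq> {Min R, Suc (Min R)}"
    using assms(2)[of "Min R"] Min_le[OF assms(1)] by (force simp: ldist_def)
  then show ?thesis using card_mono[of "{Min R, Suc (Min R)}" R] by simp
qed simp

lemma card_le_fibres:
  assumes "finite X" "\<And>b. b \<in> f ` X \<Longrightarrow> card {x \<in> X. f x = b} \<le> c"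
  shows "card X \<le> c * card (f ` X)"
proof -
  have "X = (\<Union>b\<in>f ` X. {x \<in> X. f x = b})" by auto
  then have "card X \<le> (\<Sum>b\<in>f ` X. card {x \<in> X. f x = b})"
    using card_UN_le[of "f ` X" "\<lambda>b. {x \<in> X. f x = b}"] assms(1) by simp
  also have "\<dots> \<le> card (f ` X) * c" using sum_bounded_above[of "f ` X" _ c] assms(2) by simp
  finally show ?thesis by (simp add: mult.commute)
qed

section \<open>Shortest paths in the cylinder\<close>

locale cylinder =
  fixes m n :: nat
  assumes m: "m \<ge> 2" and n: "n \<ge> 3"
begin

abbreviation G where "G \<equiv> path_graph m \<box> cycle_graph n"

text \<open>The sum metric. That it is the graph distance follows from \<open>D_le_vwalk\<close> (no
  walk is shorter) and \<open>corner_paths\<close> (the value is attained).\<close>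

fun D :: "nat \<times> nat \<Rightarrow> nat \<times> nat \<Rightarrow> nat" where
  "D (i, a) (j, b) = ldist i j + cdist n a b"

lemma pverts_G: "pverts G = {0..<m} \<times> {0..<n}"
  by (simp add: cartesian_product_def path_graph_def cycle_graph_def)

lemma cycle_arc:
  "(a, b) \<in> parcs (cycle_graph n) \<longleftrightarrow> a < n \<and> b < n \<and> cdist n a b = 1"
  using n by (auto simp: cycle_graph_def cdist_def ldist_def min_def mod_Suc split: if_splits)

lemma parcs_G: "(u, v) \<in> parcs G \<longleftrightarrow> u \<in> pverts G \<and> v \<in> pverts G \<and> D u v = 1"
proof -
  obtain i a where u: "u = (i, a)" by force
  obtain j b where v: "v = (j, b)" by force
  have "(i, j) \<in> parcs (path_graph m) \<longleftrightarrow> i < m \<and> j < m \<and> ldist i j = 1"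
    by (auto simp: path_graph_def ldist_def)
  then have "(u, v) \<in> parcs G \<longleftrightarrow> i < m \<and> j < m \<and> a < n \<and> b < n \<and>
      (i = j \<and> cdist n a b = 1 \<or> ldist i j = 1 \<and> a = b)"
    unfolding u v by (auto simp: cartesian_product_def cycle_arc) (auto simp: path_graph_def cycle_graph_def)
  then show ?thesis
    using cdist_eq_0[of a n b] ldist_eq_0[of i j] unfolding u v pverts_G 
    by (auto simp: add_is_1)
qed

lemma D_triangle:
  "\<lbrakk>u \<in> pverts G; v \<in> pverts G; w \<in> pverts G\<rbrakk> \<Longrightarrow> D u v \<le> D u w + D w v"
  using ldist_triangle[of "fst u" "fst v" "fst w"] cdist_triangle[of "snd u" n "snd v" "snd w"]
  by (cases u; cases v; cases w) (auto simp: pverts_G)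

lemma D_eq_0: "\<lbrakk>u \<in> pverts G; v \<in> pverts G\<rbrakk> \<Longrightarrow> D u v = 0 \<longleftrightarrow> u = v"
  by (cases u; cases v) (auto simp: pverts_G ldist_eq_0 cdist_eq_0)

text \<open>Each arc contributes 1 to \<open>D\<close>, and the triangle inequality adds the arcs
  up. The inequality is strict because \<open>length p\<close> counts vertices.\<close>

lemma D_le_vwalk:
  assumes "vwalk p (with_proj G)"
  shows "D (hd p) (last p) < length p"
  using assms
proof (induction p rule: list.induct)
  case Nil
  then show ?case by (auto simp: vwalk_def)
next
  case (Cons u p)
  show ?case
  proof (cases p)
    case Nil
    then show ?thesis using D_eq_0[of u u] Cons.prems by (auto simp: vwalk_def)
  next
    case [simp]: (Cons v q)
    have p: "(u, hd p) \<in> parcs G" "vwalk p (with_proj G)"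
      using vwalk_consE[OF Cons.prems] by auto
    then have "last p \<in> pverts G" using last_in_set[of p] by (auto simp: vwalk_def)
    then have "D u (last p) \<le> D u (hd p) + D (hd p) (last p)"
      using p(1) by (intro D_triangle) (auto simp: parcs_G)
    then show ?thesis using Cons.IH[OF p(2)] p(1) by (auto simp: parcs_G)
  qed
qed

text \<open>The tail of a geodesic walk is geodesic. If the first vertex recurred, the suffix
  starting there would be a walk shorter than the distance.\<close>

lemma vwalk_distinct:
  assumes "vwalk p (with_proj G)" "length p = Suc (D (hd p) (last p))"
  shows "distinct p"
  using assms
proof (induction p rule: list.induct)
  case (Cons u p)
  show ?case
  proof (cases p)
    case [simp]: (Cons v q)
    have p: "(u, hd p) \<in> parcs G" "vwalk p (with_proj G)"
      using vwalk_consE[OF Cons.prems(1)] by auto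
    then have l: "last p \<in> pverts G" using last_in_set[of p] by (auto simp: vwalk_def)
    then have "D u (last p) \<le> D u (hd p) + D (hd p) (last p)"
      using p(1) by (intro D_triangle) (auto simp: parcs_G)
    then have "length p = Suc (D (hd p) (last p))"
      using D_le_vwalk[OF p(2)] p(1) Cons.prems by (auto simp: parcs_G)
    then have "distinct p" using Cons.IH p(2) by blast
    moreover have "u \<notin> set p"
    proof
      assume "u \<in> set p"
      then obtain xs ys where xy: "p = xs @ u # ys" by (meson split_list)
      then have "vwalk (u # ys) (with_proj G)" "last (u # ys) = last p"
        using vwalkI_append_r[of "u # ys" xs] p(2) by auto
      with D_le_vwalk[of "u # ys"] have "D u (last p) < length (u # ys)" by auto
      moreover have "length (u # ys) \<le> length p" by (subst xy) simp
      moreover have "length p = D u (last p)" using Cons.prems(2) by simp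
      ultimately show False by linarith
    qed
    ultimately show ?thesis by simp
  qed simp
qed simp

lemma walk_in_shortest:
  assumes "walk_in G S u v (D u v)"
  obtains p where "shortest_uv_path G u v p" "length p = Suc (D u v)" "set p \<subseteq> S"
proof -
  obtain p where p: "vwalk p (with_proj G)" "hd p = u" "last p = v" "length p = Suc (D u v)" "set p \<subseteq> S"
    using assms by (auto simp: walk_in_def)
  have "distinct p" using p vwalk_distinct by simp
  moreover have "vwalk_length p \<le> vwalk_length q" if "uv_path G u v q" for q
    using that D_le_vwalk[of q] p by (auto simp: uv_path_def vpath_def)
  ultimately have "shortest_uv_path G u v p"
    using p(1-3) unfolding shortest_uv_path_def by (auto simp: uv_path_def vpath_def)
  then show ?thesis using p(4,5) that by blast
qed

section \<open>Geodesics along rows and columns\<close>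

text \<open>The metric interval: the vertices on some geodesic of the row from \<open>a\<close> to
  \<open>b\<close>. For opposite columns it is the whole row, which is why that case gets the finer
  \<open>antipodal_paths\<close>.\<close>

definition row_interval where
  "row_interval i a b = {i} \<times> {c. c < n \<and> cdist n a c + cdist n c b = cdist n a b}"

definition col_interval where
  "col_interval a i j = {x. ldist i x + ldist x j = ldist i j} \<times> {a}"

text \<open>Step to a closer column \<open>c\<close> and recurse; by the triangle inequality the
  interval from \<open>c\<close> is contained in the interval from \<open>a\<close>.\<close>

lemma row_walk:
  assumes "i < m" "a < n" "b < n"
  shows "walk_in G (row_interval i a b) (i, a) (i, b) (cdist n a b)"
  using assms(2)
proof (induction "cdist n a b" arbitrary: a)
  case 0
  then have "a = b" using assms(3) cdist_eq_0 by auto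
  then show ?case
    using 0 assms walk_in_refl[of "(i, a)" G]
    by (auto simp: pverts_G row_interval_def intro: walk_in_mono)
next
  case (Suc l)
  obtain c where c: "c < n" "cdist n a c = 1" "cdist n c b + 1 = cdist n a b"
    using cdist_step[OF Suc.prems assms(3) n] Suc.hyps(2) by force
  have "walk_in G (insert (i, a) (row_interval i c b)) (i, a) (i, b) (Suc l)"
  proof (rule walk_in_step)
    show "((i, a), (i, c)) \<in> parcs G"
      using assms Suc.prems c by (auto simp: parcs_G pverts_G ldist_eq_0)
    show "walk_in G (row_interval i c b) (i, c) (i, b) l"
      using Suc.hyps(1)[of c] c(1,3) Suc.hyps(2) by (metis Suc_eq_plus1 nat.inject)
  qed (use assms Suc.prems in \<open>auto simp: pverts_G\<close>)
  moreover have "insert (i, a) (row_interval i c b) \<subseteq> row_interval i a b"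
  proof -
    have "cdist n a x + cdist n x b = cdist n a b" if "x < n" "cdist n c x + cdist n x b = cdist n c b" for x
      using that c cdist_triangle[OF Suc.prems that(1) c(1)] cdist_triangle[OF Suc.prems assms(3) that(1)] by linarith
    then show ?thesis using Suc.prems cdist_eq_0[of a n a] by (auto simp: row_interval_def)
  qed
  ultimately show ?case using Suc.hyps(2) walk_in_mono by metis
qed

lemma col_walk:
  assumes "a < n" "i < m" "j < m"
  shows "walk_in G (col_interval a i j) (i, a) (j, a) (ldist i j)"
  using assms(2)
proof (induction "ldist i j" arbitrary: i)
  case 0
  then have "i = j" by (simp add: ldist_eq_0)
  then show ?case
    using 0 assms walk_in_refl[of "(i, a)" G]
    by (auto simp: pverts_G col_interval_def intro: walk_in_mono)
next
  case (Suc l)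
  obtain x where x: "x \<le> max i j" "ldist i x = 1" "ldist x j + 1 = ldist i j"
    using ldist_step[of i j] Suc.hyps(2) by force
  then have xm: "x < m" using Suc.prems assms(3) by linarith
  have "walk_in G (insert (i, a) (col_interval a x j)) (i, a) (j, a) (Suc l)"
  proof (rule walk_in_step)
    show "((i, a), (x, a)) \<in> parcs G"
      using assms Suc.prems x xm by (auto simp: parcs_G pverts_G cdist_eq_0)
    show "walk_in G (col_interval a x j) (x, a) (j, a) l"
      using Suc.hyps(1)[of x] xm x(3) Suc.hyps(2) by (metis Suc_eq_plus1 nat.inject)
  qed (use assms Suc.prems in \<open>auto simp: pverts_G\<close>)
  moreover have "insert (i, a) (col_interval a x j) \<subseteq> col_interval a i j"
  proof -
    have "ldist i y + ldist y j = ldist i j" if "ldist x y + ldist y j = ldist x j" for y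
      using that x ldist_triangle[of i y x] ldist_triangle[of i j y] by linarith
    then show ?thesis by (auto simp: col_interval_def ldist_eq_0)
  qed
  ultimately show ?case using Suc.hyps(2) walk_in_mono by metis
qed

lemma ex_two_paths:
  assumes "walk_in G S u v (D u v)" "walk_in G T u v (D u v)"
    "S \<inter> X \<subseteq> {u, v}" "T \<inter> X \<subseteq> {u, v}" "S \<inter> T \<subseteq> {u, v}" "{u, v} \<subseteq> X"
  shows "\<exists>Q :: nat \<Rightarrow> (nat \<times> nat) list.
    (\<forall>i\<in>{1..1+1}. shortest_uv_path G u v (Q i) \<and> set (Q i) \<inter> X = {u, v}) \<and>
    (\<forall>i\<in>{1..1+1}. \<forall>j\<in>{1..1+1}. i \<noteq> j \<longrightarrow> (set (Q i) - {u, v}) \<inter> (set (Q j) - {u, v}) = {})"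
proof -
  obtain p where p: "shortest_uv_path G u v p" "set p \<subseteq> S"
    by (metis walk_in_shortest[OF assms(1)])
  obtain q where q: "shortest_uv_path G u v q" "set q \<subseteq> T"
    by (metis walk_in_shortest[OF assms(2)])
  \<comment> \<open>The confining sets bound the intersection with \<open>X\<close> only from above;
    the ends supply the other inclusion.\<close>
  have ends: "{u, v} \<subseteq> set r" if "shortest_uv_path G u v r" for r
    using that by (cases r) (auto simp: shortest_uv_path_def uv_path_def vpath_def)
  have "{1..1+1} = {1, 2 :: nat}" by auto
  then show ?thesis
    using p q ends[OF p(1)] ends[OF q(1)] assms(3-6)
    by (intro exI[of _ "\<lambda>i. if i = 1 then p else q"]) auto
qed

text \<open>First along the row and then the column, or the other way round: the two routes turn at
  opposite corners of the rectangle.\<close>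

lemma corner_paths:
  assumes "i < m" "j < m" "a < n" "b < n"
  shows "walk_in G (row_interval i a b \<union> col_interval b i j) (i, a) (j, b) (D (i, a) (j, b))"
    "walk_in G (col_interval a i j \<union> row_interval j a b) (i, a) (j, b) (D (i, a) (j, b))"
  using walk_in_trans[OF row_walk[OF assms(1,3,4)] col_walk[OF assms(4,1,2)]]
    walk_in_trans[OF col_walk[OF assms(3,1,2)] row_walk[OF assms(2,3,4)]]
  by (simp_all add: add.commute)


text \<open>Start with the successor \<open>s\<close> or the predecessor \<open>p\<close> of
  \<open>a\<close>. From either, less than half a turn remains to \<open>b\<close>, so the remaining
  interval is a single arc, and the two arcs share only \<open>b\<close>.\<close>

lemma antipodal_paths:
  assumes "i < m" "a < n" "b < n" "2 * cdist n a b = n" "a \<noteq> b"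
  obtains A B where
    "walk_in G ({i} \<times> A) (i, a) (i, b) (D (i, a) (i, b))"
    "walk_in G ({i} \<times> B) (i, a) (i, b) (D (i, a) (i, b))"
    "A \<inter> B \<subseteq> {a, b}"
proof -
  have D: "D (i, a) (i, b) = cdist n a b" by (simp add: ldist_eq_0)
  have f: "2 * fwd n a b = n" "cdist n a b = fwd n a b"
    using assms(2-4) fwd_less[OF assms(2,3)] by (auto simp: cdist_fwd min_def split: if_splits)
  have step: "walk_in G ({i} \<times> insert a {x. x < n \<and> cdist n c x + cdist n x b = cdist n c b})
      (i, a) (i, b) (D (i, a) (i, b))"
    if c: "c < n" "cdist n a c = 1" "cdist n c b + 1 = cdist n a b" for c
  proof -
    have "walk_in G (insert (i, a) (row_interval i c b)) (i, a) (i, b) (Suc (cdist n c b))"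
      using assms c row_walk[OF assms(1) c(1) assms(3)]
      by (intro walk_in_step) (auto simp: parcs_G pverts_G ldist_eq_0)
    moreover have "insert (i, a) (row_interval i c b) =
        {i} \<times> insert a {x. x < n \<and> cdist n c x + cdist n x b = cdist n c b}"
      by (auto simp: row_interval_def)
    ultimately show ?thesis unfolding D using c(3) by (metis Suc_eq_plus1)
  qed
  obtain s where s: "s < n" "fwd n a s = 1" by (rule ex_fwd_one[OF assms(2) n])
  obtain p where p: "p < n" "fwd n p a = 1" by (rule ex_fwd_one'[OF assms(2) n])
  have fs: "fwd n s b + 1 = fwd n a b"
    using fwd_one[OF assms(2,3) s] f n by auto
  have fp: "fwd n p b = fwd n a b + 1"
    using fwd_one[OF p(1) assms(3,2) p(2)] f n by auto
  have "p \<noteq> b" using fp fwd_eq_0[OF p(1) assms(3)] by auto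
  then have fbp: "fwd n b p + 1 = fwd n a b"
    using fwd_swap[OF p(1) assms(3)] fp f by linarith
  show ?thesis
  proof (rule that)
    show "walk_in G ({i} \<times> insert a {x. x < n \<and> cdist n s x + cdist n x b = cdist n s b})
        (i, a) (i, b) (D (i, a) (i, b))"
      using s fs f n assms(2,3) by (intro step) (auto simp: cdist_fwd)
    show "walk_in G ({i} \<times> insert a {x. x < n \<and> cdist n p x + cdist n x b = cdist n p b})
        (i, a) (i, b) (D (i, a) (i, b))"
      using p fp f n assms(2,3) by (intro step) (auto simp: cdist_fwd cdist_sym[of n a p])
    \<comment> \<open>A common \<open>x\<close> other than \<open>b\<close> would lie on the arcs
      from \<open>s\<close> to \<open>b\<close> and from \<open>b\<close> to \<open>p\<close>, so
      that \<open>fwd n x b + fwd n b x\<close> is at most \<open>n - 2\<close>; but that sum is a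
      full turn.\<close>
    have "x = b" if x: "x < n" "cdist n s x + cdist n x b = cdist n s b"
      "cdist n p x + cdist n x b = cdist n p b" for x
    proof (rule ccontr)
      assume "x \<noteq> b"
      have "fwd n s x + fwd n x b = fwd n s b"
        using x f fs by (intro interval_fwd s assms) auto
      moreover have "fwd n b x + fwd n x p = fwd n b p"
        using x f fbp by (intro interval_fwd p assms) (auto simp: cdist_sym)
      ultimately show False using fwd_swap[OF x(1) assms(3) \<open>x \<noteq> b\<close>] f fs fbp by linarith
    qed
    then show "insert a {x. x < n \<and> cdist n s x + cdist n x b = cdist n s b} \<inter>
        insert a {x. x < n \<and> cdist n p x + cdist n x b = cdist n p b} \<subseteq> {a, b}"
      by blast
  qed
qed

section \<open>Lower bounds\<close>

text \<open>Pairs in one row use the two halves of the row, all others the rectangle boundary. Its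
  vertical sides avoid \<open>X\<close> by \<open>col\<close>, its horizontal sides by
  \<open>corner\<close>, applied once from each end of the pair.\<close>

lemma ftmv_setI:
  assumes "X \<subseteq> pverts G"
    and col: "\<And>i j a. (i, a) \<in> X \<Longrightarrow> (j, a) \<in> X \<Longrightarrow> i = j"
    and row: "\<And>i a b. (i, a) \<in> X \<Longrightarrow> (i, b) \<in> X \<Longrightarrow> a \<noteq> b \<Longrightarrow> cdist n a b \<noteq> 1 \<Longrightarrow>
      2 * cdist n a b = n \<and> (\<forall>c. (i, c) \<in> X \<longrightarrow> c \<in> {a, b})"
    and corner: "\<And>i j a b c. (i, a) \<in> X \<Longrightarrow> (i, c) \<in> X \<Longrightarrow> (j, b) \<in> X \<Longrightarrow> i \<noteq> j \<Longrightarrow>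
      cdist n a c + cdist n c b = cdist n a b \<Longrightarrow> c = a"
  shows "ftmv_set 1 G X"
  unfolding ftmv_set_def
proof (intro conjI ballI impI)
  fix u v assume uv: "u \<in> X" "v \<in> X" "u \<noteq> v" "(u, v) \<notin> parcs G"
  obtain i a where u: "u = (i, a)" by force
  obtain j b where v: "v = (j, b)" by force
  have bounds: "i < m" "j < m" "a < n" "b < n"
    using uv(1,2) assms(1) by (auto simp: u v pverts_G)
  have X: "{u, v} \<subseteq> X" using uv by simp
  show "\<exists>Q :: nat \<Rightarrow> (nat \<times> nat) list.
    (\<forall>i\<in>{1..1+1}. shortest_uv_path G u v (Q i) \<and> set (Q i) \<inter> X = {u, v}) \<and>
    (\<forall>i\<in>{1..1+1}. \<forall>j\<in>{1..1+1}. i \<noteq> j \<longrightarrow> (set (Q i) - {u, v}) \<inter> (set (Q j) - {u, v}) = {})"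
  proof (cases "i = j")
    case True
    then have ab: "a \<noteq> b" "cdist n a b \<noteq> 1"
      using uv(3,4) bounds by (auto simp: u v parcs_G pverts_G ldist_eq_0)
    have opp: "2 * cdist n a b = n" "\<And>c. (i, c) \<in> X \<Longrightarrow> c \<in> {a, b}"
      using row[of i a b] uv(1,2) ab True by (auto simp: u v)
    obtain A B where AB: "walk_in G ({i} \<times> A) (i, a) (i, b) (D (i, a) (i, b))"
      "walk_in G ({i} \<times> B) (i, a) (i, b) (D (i, a) (i, b))" "A \<inter> B \<subseteq> {a, b}"
      by (rule antipodal_paths[OF bounds(1,3,4) opp(1) ab(1)])
    show ?thesis
      using AB opp(2) X True
      by (intro ex_two_paths[of "{i} \<times> A" u v "{i} \<times> B"]) (auto simp: u v)
  next
    case False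
    then have ab: "a \<noteq> b" using col uv(1,2) u v by blast
    have "c = a" if "(i, c) \<in> X" "cdist n a c + cdist n c b = cdist n a b" for c
      using corner[of i a c j b] uv(1,2) False that by (auto simp: u v)
    moreover have "c = b" if "(j, c) \<in> X" "cdist n a c + cdist n c b = cdist n a b" for c
      using corner[of j b c i a] uv(1,2) False that by (auto simp: u v cdist_sym add.commute)
    moreover have "x = i" if "(x, a) \<in> X" for x using col that uv(1) u by blast
    moreover have "x = j" if "(x, b) \<in> X" for x using col that uv(2) v by blast
    ultimately show ?thesis
      using X False ab
      by (intro ex_two_paths[OF corner_paths[OF bounds, folded u v]])
        (auto simp: row_interval_def col_interval_def u v)
  qed
qed (rule assms(1))

text \<open>There is no non-adjacent pair, so the condition is vacuous for every
  \<open>k\<close>.\<close>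

lemma ftmv_set_clique:
  assumes "X \<subseteq> pverts G" "\<And>u v. u \<in> X \<Longrightarrow> v \<in> X \<Longrightarrow> u \<noteq> v \<Longrightarrow> D u v = 1"
  shows "ftmv_set k G X"
  using assms unfolding ftmv_set_def parcs_G by blast

lemma ftmv_antipodal:
  assumes "n = 2 * h" "q \<le> m" "q \<le> h"
  defines "X \<equiv> (\<lambda>t. (t, t)) ` {..<q} \<union> (\<lambda>t. (t, t + h)) ` {..<q}"
  shows "ftmv_set 1 G X" "card X = 2 * q"
proof -
  have X: "(i, a) \<in> X \<longleftrightarrow> i < q \<and> (a = i \<or> a = i + h)" for i a
    by (auto simp: X_def)
  have row: "a \<noteq> b \<Longrightarrow> 2 * cdist n a b = n" if "(i, a) \<in> X" "(i, b) \<in> X" for i a b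
    using that assms(1) by (auto simp: X cdist_def ldist_def)
  have col: "i = j" if "(i, a) \<in> X" "(j, a) \<in> X" for i j a
    using that assms(3) by (auto simp: X)
  have sub: "X \<subseteq> pverts G" unfolding pverts_G using assms(1-3) by (auto simp: X_def)
  show "ftmv_set 1 G X"
  proof (rule ftmv_setI[OF sub col])
    fix i j a b c
    assume *: "(i, a) \<in> X" "(i, c) \<in> X" "(j, b) \<in> X" "i \<noteq> j"
      "cdist n a c + cdist n c b = cdist n a b"
    show "c = a"
    proof (rule ccontr)
      assume "c \<noteq> a"
      \<comment> \<open>The distance from \<open>a\<close> to its opposite \<open>c\<close> is
        already the largest possible, so nothing is left between \<open>c\<close> and
        \<open>b\<close>.\<close>
      then have "cdist n c b = 0" using row[of i a c] *(1,2,5) cdist_le[of n a b] by auto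
      then have "c = b" using *(2,3) sub cdist_eq_0[of c n b] unfolding pverts_G by fastforce
      then show False using col * by blast
    qed
  qed (use row in \<open>auto simp: X\<close>)
  have "card X = card ((\<lambda>t. (t, t)) ` {..<q}) + card ((\<lambda>t. (t, t + h)) ` {..<q})"
    unfolding X_def using assms(3) by (intro card_Un_disjoint) auto
  then show "card X = 2 * q" by (simp add: card_image inj_on_def)
qed

lemma ftmv_diagonal:
  assumes "q \<le> m" "q \<le> n"
  shows "ftmv_set 1 G ((\<lambda>t. (t, t)) ` {..<q})"
  using assms by (intro ftmv_setI) (auto simp: pverts_G)

text \<open>Column \<open>h + 1\<close> is at distance \<open>h\<close> from both columns 0 and 1,
  so neither vertex of the adjacent pair lies on the way from the other to the third vertex.\<close>

lemma ftmv_odd_triple: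
  assumes "n = 2 * h + 1" "h \<ge> 2"
  shows "ftmv_set 1 G {(0, 0), (0, 1), (1, h + 1)}"
proof (rule ftmv_setI)
  show "{(0, 0), (0, 1), (1, h + 1)} \<subseteq> pverts G"
    unfolding pverts_G using assms m by auto
qed (use assms in \<open>auto simp: cdist_def ldist_def\<close>)


section \<open>Upper bounds\<close>

definition closer :: "nat \<times> nat \<Rightarrow> nat \<times> nat \<Rightarrow> (nat \<times> nat) set" where
  "closer u v = {w \<in> pverts G. D u w = 1 \<and> D w v + 1 = D u v}"

lemma finite_closer: "finite (closer u v)"
  by (rule finite_subset[of _ "pverts G"]) (auto simp: closer_def pverts_G)

lemma shortest_first_step:
  assumes "shortest_uv_path G u v p" "D u v \<ge> 2"
  obtains w where "w \<in> set p" "w \<in> closer u v"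
proof -
  have p: "vwalk p (with_proj G)" "hd p = u" "last p = v"
    using assms(1) by (auto simp: shortest_uv_path_def uv_path_def vpath_def)
  then have uv: "u \<in> pverts G" "v \<in> pverts G"
    using hd_in_set[of p] last_in_set[of p] by (auto simp: vwalk_def)
  \<comment> \<open>An explicit geodesic caps the length of \<open>p\<close>; the rest of
    \<open>p\<close> after its second vertex \<open>w\<close> then shows that \<open>w\<close> is
    one step nearer to \<open>v\<close>.\<close>
  obtain i a j b where "u = (i, a)" "v = (j, b)" by (metis surj_pair)
  then have "walk_in G (row_interval i a b \<union> col_interval b i j) u v (D u v)"
    using uv corner_paths(1)[of i j a b] by (auto simp: pverts_G)
  then obtain q where "shortest_uv_path G u v q" "length q = Suc (D u v)"
    by (rule walk_in_shortest)
  then have len: "length p \<le> Suc (D u v)"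
    using assms(1) unfolding shortest_uv_path_def by fastforce
  have "length p > 2" using D_le_vwalk[OF p(1)] p assms(2) by auto
  then obtain w r where r: "p = u # w # r" using p(2)
    by (cases p; cases "tl p") auto
  have arc: "(u, w) \<in> parcs G" and wr: "vwalk (w # r) (with_proj G)"
    using vwalk_consE[of u "w # r" "with_proj G"] p(1) r by auto
  have w: "w \<in> pverts G" "D u w = 1" using arc by (auto simp: parcs_G)
  have "D w v < length (w # r)" using D_le_vwalk[OF wr] p(3) r by simp
  moreover have "D u v \<le> D u w + D w v" using uv w by (intro D_triangle)
  ultimately have "w \<in> closer u v" using w len r by (auto simp: closer_def)
  then show ?thesis using that[of w] r by simp
qed

lemma card_closer:
  assumes "a < n" "b < n"
  shows "card (closer (i, a) (j, b)) \<le>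
    (if i = j then 0 else 1) + (if a = b then 0 else if 2 * cdist n a b = n then 2 else 1)"
proof -
  define L where "L = {x. ldist i x = 1 \<and> ldist x j + 1 = ldist i j}"
  define C where "C = {c. c < n \<and> cdist n a c = 1 \<and> cdist n c b + 1 = cdist n a b}"
  have L: "finite L \<and> card L \<le> 1"
    unfolding L_def by (rule card_le_1I) (auto intro: ldist_closer_unique)
  have L0: "L = {}" if "i = j" using that ldist_eq_0[of i i] by (auto simp: L_def)
  have C2: "card C \<le> 2"
  proof -
    \<comment> \<open>A column has one successor and one predecessor on the cycle.\<close>
    let ?S = "{c. c < n \<and> fwd n a c = 1}" and ?P = "{c. c < n \<and> fwd n c a = 1}"
    have "finite ?S \<and> card ?S \<le> 1" "finite ?P \<and> card ?P \<le> 1"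
      by (rule card_le_1I; use assms(1) fwd_inj fwd_inj_left in force)+
    moreover have "C \<subseteq> ?S \<union> ?P" using assms(1) cdist_one_fwd by (auto simp: C_def)
    ultimately show ?thesis using card_mono[of "?S \<union> ?P" C] card_Un_le[of ?S ?P] by simp
  qed
  have C1: "card C \<le> 1" if "2 * cdist n a b \<noteq> n"
    using card_le_1I[of C] cdist_closer_unique[OF assms _ _ that] unfolding C_def by blast
  have C0: "C = {}" if "a = b" using that assms(1) cdist_eq_0[of a n a] by (auto simp: C_def)
  have finC: "finite C" unfolding C_def by simp
  have C: "card C \<le> (if a = b then 0 else if 2 * cdist n a b = n then 2 else 1)"
    using C2 C1 C0 by (cases "a = b"; cases "2 * cdist n a b = n") simp_all
  \<comment> \<open>Distance one from \<open>(i, a)\<close> means that exactly one coordinate moves,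
    by one step.\<close>
  have "closer (i, a) (j, b) \<subseteq> (\<lambda>x. (x, a)) ` L \<union> Pair i ` C"
  proof
    fix w assume w: "w \<in> closer (i, a) (j, b)"
    obtain x c where wxc: "w = (x, c)" by force
    have "x = i \<or> c = a"
      using w assms by (auto simp: wxc closer_def pverts_G add_is_1 ldist_eq_0 cdist_eq_0)
    then show "w \<in> (\<lambda>x. (x, a)) ` L \<union> Pair i ` C"
      using w assms cdist_eq_0[of a n a] ldist_eq_0[of i i]
      by (auto simp: wxc closer_def pverts_G L_def C_def)
  qed
  then have "card (closer (i, a) (j, b)) \<le> card ((\<lambda>x. (x, a)) ` L \<union> Pair i ` C)"
    using L finC by (intro card_mono) auto
  also have "\<dots> \<le> card L + card C"
    using card_Un_le[of "(\<lambda>x. (x, a)) ` L" "Pair i ` C"] by (simp add: card_image inj_on_def)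
  also have "\<dots> \<le> (if i = j then 0 else 1) +
      (if a = b then 0 else if 2 * cdist n a b = n then 2 else 1)"
  proof (rule add_mono[OF _ C])
    show "card L \<le> (if i = j then 0 else 1)"
      using L L0 by simp
  qed
  finally show ?thesis .
qed

section \<open>Local constraints on a fault-tolerant set\<close>

context
  fixes k :: nat and X :: "(nat \<times> nat) set"
  assumes X: "ftmv_set k G X"
begin

lemma in_range: "(i, a) \<in> X \<Longrightarrow> i < m \<and> a < n"
  using X by (auto simp: ftmv_set_def pverts_G)

lemma finite_X: "finite X"
  by (rule finite_subset[of _ "{..<m} \<times> {..<n}"]) (use in_range in auto)

lemma closer_count:
  assumes "u \<in> X" "v \<in> X" "D u v \<ge> 2"
  shows "k + 1 + card (closer u v \<inter> X) \<le> card (closer u v)"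
proof -
  have V: "u \<in> pverts G" "v \<in> pverts G" using X assms by (auto simp: ftmv_set_def)
  have "u \<noteq> v" "(u, v) \<notin> parcs G" using assms(3) V D_eq_0[of u u] by (auto simp: parcs_G)
  then obtain Q :: "nat \<Rightarrow> (nat \<times> nat) list" where
    Q: "\<And>i. i \<in> {1..k+1} \<Longrightarrow> shortest_uv_path G u v (Q i)"
       "\<And>i. i \<in> {1..k+1} \<Longrightarrow> set (Q i) \<inter> X = {u, v}"
       "\<And>i j. i \<in> {1..k+1} \<Longrightarrow> j \<in> {1..k+1} \<Longrightarrow> i \<noteq> j \<Longrightarrow>
          (set (Q i) - {u, v}) \<inter> (set (Q j) - {u, v}) = {}"
    using X assms(1,2) unfolding ftmv_set_def by metis
  have "\<forall>i\<in>{1..k+1}. \<exists>w. w \<in> set (Q i) \<and> w \<in> closer u v"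
    using shortest_first_step[OF Q(1) assms(3)] by metis
  then obtain f where f: "\<And>i. i \<in> {1..k+1} \<Longrightarrow> f i \<in> set (Q i) \<and> f i \<in> closer u v"
    by metis
  have ne: "w \<noteq> u" "w \<noteq> v" if "w \<in> closer u v" for w
    using that assms(3) V D_eq_0[of u u] by (auto simp: closer_def)
  have "inj_on f {1..k+1}"
  proof (rule inj_onI, rule ccontr)
    fix i j assume ij: "i \<in> {1..k+1}" "j \<in> {1..k+1}" "f i = f j" "i \<noteq> j"
    then have "f i \<in> (set (Q i) - {u, v}) \<inter> (set (Q j) - {u, v})"
      using f[OF ij(1)] f[OF ij(2)] ne[of "f i"] by simp
    then show False using Q(3)[OF ij(1,2,4)] by blast
  qed
  then have "card (f ` {1..k+1}) = k + 1" by (simp add: card_image)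
  moreover have "f i \<in> closer u v - X" if i: "i \<in> {1..k+1}" for i
    using f[OF i] Q(2)[OF i] ne[of "f i"] by blast
  then have "f ` {1..k+1} \<subseteq> closer u v - X" by blast
  ultimately have "k + 1 \<le> card (closer u v - X)"
    using card_mono[of "closer u v - X"] finite_closer by (metis finite_Diff)
  then show ?thesis
    using card_Diff_subset_Int[of "closer u v" X] finite_closer[of u v]
      card_mono[of "closer u v" "closer u v \<inter> X"] by auto
qed

lemma closer_bound:
  assumes "(i, a) \<in> X" "(j, b) \<in> X" "D (i, a) (j, b) \<ge> 2"
  shows "k + 1 + card (closer (i, a) (j, b) \<inter> X) \<le>
    (if i = j then 0 else 1) + (if a = b then 0 else if 2 * cdist n a b = n then 2 else 1)"
  by (rule order_trans[OF closer_count[OF assms] card_closer]) (use in_range assms in blast)+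

text \<open>With \<open>w\<close> in \<open>X\<close> the count needs at least
  \<open>k + 2 \<ge> 3\<close> closer neighbours. Three is the maximum and occurs only for opposite
  columns.\<close>

lemma closer_blocked:
  assumes "(i, a) \<in> X" "(j, b) \<in> X" "w \<in> X" "w \<in> closer (i, a) (j, b)" "D (i, a) (j, b) \<ge> 2"
    "k \<ge> 1"
  shows "k = 1 \<and> 2 * cdist n a b = n"
proof -
  have "card (closer (i, a) (j, b) \<inter> X) \<ge> 1"
    using assms(3,4) finite_closer by (metis IntI One_nat_def Suc_leI card_gt_0_iff emptyE finite_Int)
  then show ?thesis
    using closer_bound[OF assms(1,2,5)] assms(6) by (auto split: if_splits)
qed

text \<open>Within a column there is only one closer neighbour, but at least two are required at
  distance 2 or more.\<close>

lemma same_column: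
  assumes "(i, a) \<in> X" "(j, a) \<in> X" "k \<ge> 1"
  shows "ldist i j \<le> 1"
proof (rule ccontr)
  assume "\<not> ?thesis"
  then have "D (i, a) (j, a) \<ge> 2" by simp
  from closer_bound[OF assms(1,2) this] show False using assms(3) by (auto split: if_splits)
qed

lemma same_row:
  assumes "(i, a) \<in> X" "(i, b) \<in> X" "k \<ge> 1"
  shows "cdist n a b \<le> 1 \<or> k = 1 \<and> 2 * cdist n a b = n"
proof (rule ccontr)
  assume *: "\<not> ?thesis"
  then have "D (i, a) (i, b) \<ge> 2" by simp
  from closer_bound[OF assms(1,2) this] show False using assms(3) * by (auto split: if_splits)
qed

text \<open>For \<open>k \<ge> 2\<close> all three possible closer neighbours must exist.\<close>

lemma far_pair:
  assumes "(i, a) \<in> X" "(j, b) \<in> X" "D (i, a) (j, b) \<ge> 2" "k \<ge> 2"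
  shows "i \<noteq> j \<and> 2 * cdist n a b = n"
  using closer_bound[OF assms(1-3)] assms(4) by (auto split: if_splits)

text \<open>Of the two vertices in column \<open>a\<close>, the one nearer to row \<open>j\<close>
  blocks the other on its way to \<open>(j, b)\<close>.\<close>

lemma vertical_pair:
  assumes "(i, a) \<in> X" "(Suc i, a) \<in> X" "(j, b) \<in> X" "a \<noteq> b" "k \<ge> 1"
  shows "k = 1 \<and> 2 * cdist n a b = n"
proof -
  have range: "i < m" "Suc i < m" "j < m" "a < n" "b < n"
    using in_range assms(1-3) by auto
  have ab: "cdist n a b \<noteq> 0" "cdist n a a = 0" using cdist_eq_0 range assms(4) by auto
  show ?thesis
  proof (cases "j \<le> i")
    case True
    then have l: "ldist (Suc i) i = 1" "ldist i j + 1 = ldist (Suc i) j" by (auto simp: ldist_def)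
    show ?thesis
    proof (rule closer_blocked[OF assms(2,3,1) _ _ assms(5)])
      show "(i, a) \<in> closer (Suc i, a) (j, b)" using l ab range by (simp add: closer_def pverts_G)
      show "D (Suc i, a) (j, b) \<ge> 2" using l(2) ab(1) by simp
    qed
  next
    case False
    then have l: "ldist i (Suc i) = 1" "ldist (Suc i) j + 1 = ldist i j" by (auto simp: ldist_def)
    show ?thesis
    proof (rule closer_blocked[OF assms(1,3,2) _ _ assms(5)])
      show "(Suc i, a) \<in> closer (i, a) (j, b)" using l ab range by (simp add: closer_def pverts_G)
      show "D (i, a) (j, b) \<ge> 2" using l(2) ab(1) by simp
    qed
  qed
qed

text \<open>\<open>(i, a)\<close> blocks \<open>(i, a')\<close> on its way to \<open>(j, b)\<close>;
  distinct rows keep the distance at least 2 even if \<open>a = b\<close>.\<close>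

lemma horizontal_pair:
  assumes "(i, a) \<in> X" "(i, a') \<in> X" "(j, b) \<in> X" "i \<noteq> j" "cdist n a a' = 1"
    "cdist n a b + 1 = cdist n a' b" "k \<ge> 1"
  shows "k = 1 \<and> 2 * cdist n a' b = n"
proof (rule closer_blocked[OF assms(2,3,1) _ _ assms(7)])
  show "(i, a) \<in> closer (i, a') (j, b)"
    using in_range[OF assms(1)] assms(5,6)
    by (auto simp: closer_def pverts_G ldist_eq_0 cdist_sym[of n a' a])
  have "ldist i j \<noteq> 0" using assms(4) ldist_eq_0 by simp
  then have "ldist i j + cdist n a' b \<ge> 2" using assms(6) by linarith
  then show "2 \<le> D (i, a') (j, b)" by simp
qed

section \<open>Counting by rows and columns\<close>

lemma card_columns_le: "card (snd ` X) \<le> n"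
proof -
  have "snd ` X \<subseteq> {..<n}" using in_range by auto
  then show ?thesis using card_mono[of "{..<n}"] by simp
qed

lemma card_rows_le: "card (fst ` X) \<le> m"
proof -
  have "fst ` X \<subseteq> {..<m}" using in_range by auto
  then show ?thesis using card_mono[of "{..<m}"] by simp
qed

lemma column_fibre:
  assumes "k \<ge> 1"
  shows "card {x \<in> X. snd x = a} \<le> 2"
proof -
  let ?F = "{x \<in> X. snd x = a}"
  have "inj_on fst ?F" by (auto simp: inj_on_def)
  then have "card ?F = card (fst ` ?F)" by (simp add: card_image)
  also have "\<dots> \<le> 2"
    using finite_X same_column[OF _ _ assms] by (intro card_le_2_consecutive) auto
  finally show ?thesis .
qed

lemma card_le_twice_columns: "k \<ge> 1 \<Longrightarrow> card X \<le> 2 * card (snd ` X)"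
  by (rule card_le_fibres[OF finite_X column_fibre])

lemma columns_injective:
  assumes "\<And>i a. (i, a) \<in> X \<Longrightarrow> (Suc i, a) \<notin> X" "k \<ge> 1"
  shows "card X = card (snd ` X)"
proof -
  have "inj_on snd X"
  proof (rule inj_onI)
    fix x y assume xy: "x \<in> X" "y \<in> X" "snd x = snd y"
    then have "ldist (fst x) (fst y) \<le> 1"
      using same_column[of "fst x" "snd x" "fst y"] assms(2) by (metis prod.collapse)
    then have "fst x = fst y \<or> fst x = Suc (fst y) \<or> fst y = Suc (fst x)"
      by (auto simp: ldist_def split: if_splits)
    then show "x = y" using xy assms(1) by (cases x; cases y) auto
  qed
  then show ?thesis by (simp add: card_image)
qed

lemma card_opposite:
  assumes "a < n"
  shows "finite {b. b < n \<and> 2 * cdist n a b = n}" "card {b. b < n \<and> 2 * cdist n a b = n} \<le> 1"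
  using card_le_1I[of "{b. b < n \<and> 2 * cdist n a b = n}"] cdist_opposite_unique[OF assms] by blast+

text \<open>By \<open>vertical_pair\<close> every other column that is used is opposite to
  \<open>a\<close>. This leaves at most two columns with at most two vertices each, and only column
  \<open>a\<close> if \<open>k \<ge> 2\<close> or \<open>n\<close> is odd.\<close>

lemma card_vertical:
  assumes "(i, a) \<in> X" "(Suc i, a) \<in> X" "k \<ge> 1"
  shows "card X \<le> 4" "k \<ge> 2 \<or> odd n \<Longrightarrow> card X \<le> 2"
proof -
  have a: "a < n" using in_range assms(1) by blast
  have sub: "snd ` X \<subseteq> insert a {b. b < n \<and> k = 1 \<and> 2 * cdist n a b = n}" (is "_ \<subseteq> insert a ?O")
    using vertical_pair[OF assms(1,2) _ _ assms(3)] in_range by fastforce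
  have O: "finite ?O" "card ?O \<le> 1"
    using card_opposite[OF a] by (cases "k = 1"; simp)+
  have "card (snd ` X) \<le> 2"
    using card_mono[OF _ sub] O card_insert_le_m1[of 2 ?O a] by simp
  then show "card X \<le> 4" using card_le_twice_columns[OF assms(3)] by linarith
  assume "k \<ge> 2 \<or> odd n"
  then have "\<not> (k = 1 \<and> 2 * cdist n a b = n)" for b by presburger
  then have "?O = {}" by simp
  from sub[unfolded this] have "card (snd ` X) \<le> card {a}" by (intro card_mono) auto
  then show "card X \<le> 2" using card_le_twice_columns[OF assms(3)] by simp
qed

text \<open>The distances from adjacent columns to \<open>b\<close> differ by at most one. If they
  differ and the rows are distinct, the farther vertex is blocked. In a common row,
  \<open>same_row\<close> applies, and a cycle with \<open>n \<ge> 4\<close> has no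
  triangle.\<close>

lemma horizontal_cases:
  assumes "(i, a) \<in> X" "(i, a') \<in> X" "cdist n a a' = 1" "(j, b) \<in> X" "n \<ge> 4" "k \<ge> 1"
  shows "b = a \<or> b = a' \<or> k = 1 \<and> (2 * cdist n a b = n \<or> 2 * cdist n a' b = n) \<or>
    i \<noteq> j \<and> cdist n a b = cdist n a' b"
proof (cases "i = j")
  case True
  then show ?thesis
    using same_row[of i a b] same_row[of i a' b] assms cdist_no_triangle[of a n a' b]
      in_range[OF assms(1)] in_range[OF assms(2)] in_range[OF assms(4)] by auto
next
  case False
  have "cdist n a b \<le> cdist n a a' + cdist n a' b" "cdist n a' b \<le> cdist n a' a + cdist n a b"
    using cdist_triangle in_range[OF assms(1)] in_range[OF assms(2)] in_range[OF assms(4)] by auto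
  then have "cdist n a b = cdist n a' b \<or> cdist n a b + 1 = cdist n a' b \<or> cdist n a' b + 1 = cdist n a b"
    using assms(3) cdist_sym[of n a a'] by linarith
  then show ?thesis
    using False horizontal_pair[OF assms(1,2,4) False assms(3)]
      horizontal_pair[OF assms(2,1,4) False] assms(3,6) cdist_sym[of n a a'] by auto
qed

text \<open>A vertical pair allows four vertices; so does a horizontal pair, with its two columns
  and their opposites, since equidistant columns do not exist. Four is within the bound by
  \<open>m \<ge> 2\<close> and \<open>n \<ge> 4\<close>. Otherwise columns hold at most one vertex
  and rows at most two.\<close>

lemma card_le_even:
  assumes "k = 1" "n \<ge> 4" "even n"
  shows "card X \<le> min (2 * m) n"
proof (cases "\<exists>i a. (i, a) \<in> X \<and> (Suc i, a) \<in> X")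
  case True
  then show ?thesis using card_vertical(1) assms m by force
next
  case False
  then have cols: "card X = card (snd ` X)" using columns_injective assms(1) by auto
  show ?thesis
  proof (cases "\<exists>i a a'. (i, a) \<in> X \<and> (i, a') \<in> X \<and> cdist n a a' = 1")
    case True
    then obtain i a a' where ia: "(i, a) \<in> X" "(i, a') \<in> X" "cdist n a a' = 1" by blast
    have a: "a < n" "a' < n" using in_range ia by auto
    let ?O = "\<lambda>a. {b. b < n \<and> 2 * cdist n a b = n}"
    have "snd ` X \<subseteq> {a, a'} \<union> ?O a \<union> ?O a'"
      using horizontal_cases[OF ia _ assms(2)] in_range assms cdist_neq_even[OF a _ assms(3) ia(3)]
      by fastforce
    then have "card (snd ` X) \<le> card ({a, a'} \<union> ?O a \<union> ?O a')"
      using card_opposite a by (intro card_mono) auto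
    also have "\<dots> \<le> card {a, a'} + card (?O a) + card (?O a')"
      by (meson add_mono_thms_linordered_semiring(3) card_Un_le le_trans)
    also have "\<dots> \<le> 4" using card_opposite[OF a(1)] card_opposite[OF a(2)] card_insert_le_m1[of 2 "{a'}" a] by simp
    finally show ?thesis using cols m assms by simp
  next
    case no_pair: False
    have "card {x \<in> X. fst x = i} \<le> 2" if i: "i \<in> fst ` X" for i
    proof -
      obtain a where a: "(i, a) \<in> X" using i by auto
      let ?O = "{b. b < n \<and> 2 * cdist n a b = n}"
      have "{x \<in> X. fst x = i} \<subseteq> Pair i ` insert a ?O"
      proof
        fix x assume x: "x \<in> {x \<in> X. fst x = i}"
        then obtain b where b: "x = (i, b)" "(i, b) \<in> X" by (cases x) auto
        then have "cdist n a b \<le> 1 \<or> 2 * cdist n a b = n" using same_row a assms(1) by blast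
        moreover have "cdist n a b \<noteq> 1" using no_pair a b by blast
        ultimately have "a = b \<or> 2 * cdist n a b = n"
          using cdist_eq_0 in_range[OF a] in_range[OF b(2)] by (metis One_nat_def le_Suc_eq le_zero_eq)
        then show "x \<in> Pair i ` insert a ?O" using b in_range by auto
      qed
      then have "card {x \<in> X. fst x = i} \<le> card (Pair i ` insert a ?O)"
        using card_opposite in_range[OF a] by (intro card_mono) auto
      also have "\<dots> = card (insert a ?O)" by (rule card_image) (simp add: inj_on_def)
      also have "\<dots> \<le> 2" using card_opposite[of a] in_range[OF a] card_insert_le_m1[of 2 ?O a] by simp
      finally show ?thesis .
    qed
    then have "card X \<le> 2 * card (fst ` X)" by (rule card_le_fibres[OF finite_X])
    then show ?thesis using card_rows_le card_columns_le cols by simp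
  qed
qed

text \<open>Without opposite columns, a horizontal pair leaves room for just one more column, the
  equidistant one, giving 3. With no adjacent pair both projections are injective, giving
  \<open>min m n\<close>.\<close>

lemma card_le_odd:
  assumes "k = 1" "n \<ge> 5" "odd n"
  shows "card X \<le> max 3 (min m n)"
proof (cases "\<exists>i a. (i, a) \<in> X \<and> (Suc i, a) \<in> X")
  case True
  then show ?thesis using card_vertical(2) assms by fastforce
next
  case False
  then have cols: "card X = card (snd ` X)" using columns_injective assms(1) by auto
  have opp: "2 * cdist n a b \<noteq> n" for a b using assms(3) by presburger
  show ?thesis
  proof (cases "\<exists>i a a'. (i, a) \<in> X \<and> (i, a') \<in> X \<and> cdist n a a' = 1")
    case True
    then obtain i a a' where ia: "(i, a) \<in> X" "(i, a') \<in> X" "cdist n a a' = 1" by blast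
    have a: "a < n" "a' < n" using in_range ia by auto
    let ?E = "{b. b < n \<and> cdist n a b = cdist n a' b}"
    have E: "finite ?E \<and> card ?E \<le> 1"
      using assms cdist_equidistant_unique[OF a _ _ assms(3) _ ia(3)] by (intro card_le_1I) auto
    have "snd ` X \<subseteq> {a, a'} \<union> ?E"
      using horizontal_cases[OF ia] in_range assms(1,2) opp by fastforce
    then have "card (snd ` X) \<le> card ({a, a'} \<union> ?E)"
      using E by (intro card_mono) auto
    also have "\<dots> \<le> card {a, a'} + card ?E" by (rule card_Un_le)
    also have "\<dots> \<le> 3" using E card_insert_le_m1[of 2 "{a'}" a] by simp
    finally show ?thesis using cols by simp
  next
    case no_pair: False
    have "inj_on fst X"
    proof (rule inj_onI)
      fix x y assume xy: "x \<in> X" "y \<in> X" "fst x = fst y"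
      obtain i a b where x: "x = (i, a)" "y = (i, b)" using xy(3) by (metis prod.collapse)
      have "cdist n a b \<le> 1" using same_row[of i a b] xy x assms(1) opp by auto
      moreover have "cdist n a b \<noteq> 1" using no_pair xy x by blast
      ultimately have "cdist n a b = 0" by linarith
      then show "x = y" using cdist_eq_0[of a n b] in_range xy x by auto
    qed
    then have "card X = card (fst ` X)" by (simp add: card_image)
    then show ?thesis using card_rows_le card_columns_le cols by simp
  qed
qed

lemma card_le_triangular:
  assumes "k \<ge> 1" "n = 3"
  shows "card X \<le> 3"
proof (cases "\<exists>i a. (i, a) \<in> X \<and> (Suc i, a) \<in> X")
  case True
  then show ?thesis using card_vertical(2) assms by fastforce
next
  case False
  then show ?thesis using columns_injective assms card_columns_le by fastforce
qed

lemma card_le_two: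
  assumes "k \<ge> 2" "n \<ge> 4"
  shows "card X \<le> 2"
proof (cases "\<exists>i a. (i, a) \<in> X \<and> (Suc i, a) \<in> X")
  case True
  then show ?thesis using card_vertical(2) assms by fastforce
next
  case False
  then have cols: "card X = card (snd ` X)" using columns_injective assms(1) by auto
  have far: "i \<noteq> j \<and> 2 * cdist n a b = n"
    if "(i, a) \<in> X" "(j, b) \<in> X" "a \<noteq> b" "i \<noteq> j \<or> cdist n a b \<noteq> 1" for i j a b
  proof (rule far_pair[OF that(1,2) _ assms(1)])
    have "cdist n a b \<noteq> 0" using that cdist_eq_0[of a n b] in_range by blast
    then show "D (i, a) (j, b) \<ge> 2" using that(4) ldist_eq_0[of i j] by auto
  qed
  show ?thesis
  proof (cases "\<exists>i a a'. (i, a) \<in> X \<and> (i, a') \<in> X \<and> cdist n a a' = 1")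
    case True
    then obtain i a a' where ia: "(i, a) \<in> X" "(i, a') \<in> X" "cdist n a a' = 1" by blast
    have a: "a < n" "a' < n" using in_range ia by auto
    have "b \<in> {a, a'}" if b: "(j, b) \<in> X" for j b
    proof (rule ccontr)
      assume ne: "b \<notin> {a, a'}"
      then have "i \<noteq> j" "cdist n a b = cdist n a' b"
        using horizontal_cases[OF ia b assms(2)] assms(1) by auto
      \<comment> \<open>A third column would be both opposite to \<open>a\<close>, which makes
        \<open>n\<close> even, and equidistant from \<open>a\<close> and \<open>a'\<close>, which an
        even cycle forbids.\<close>
      moreover have "even n" using far[OF ia(1) b] ne \<open>i \<noteq> j\<close> by (metis dvd_triv_left insertI1)
      ultimately show False
        using cdist_neq_even[OF a _ _ ia(3)] in_range[OF b] by blast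
    qed
    then have "snd ` X \<subseteq> {a, a'}" by fastforce
    then have "card (snd ` X) \<le> card {a, a'}" by (intro card_mono) auto
    also have "\<dots> \<le> 2" using card_insert_le_m1[of 2 "{a'}" a] by simp
    finally show ?thesis using cols by simp
  next
    case no_pair: False
    show ?thesis
    proof (cases "X = {}")
      case nonempty: False
      then obtain i a where a: "(i, a) \<in> X" by auto
      let ?O = "{b. b < n \<and> 2 * cdist n a b = n}"
      have "snd ` X \<subseteq> insert a ?O"
      proof
        fix b assume "b \<in> snd ` X"
        then obtain j where "(j, b) \<in> X" by auto
        then show "b \<in> insert a ?O" using far[OF a] no_pair a in_range by blast
      qed
      then have "card (snd ` X) \<le> card (insert a ?O)"
        using card_opposite in_range[OF a] by (intro card_mono) auto
      also have "\<dots> \<le> 2" using card_opposite[of a] in_range[OF a] card_insert_le_m1[of 2 ?O a] by simp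
      finally show ?thesis using cols by simp
    qed simp
  qed
qed

end

section \<open>The four values\<close>

lemma finite_pverts_G: "finite (pverts G)"
  by (simp add: pverts_G)

lemma ftmv_number_triangular:
  assumes "k \<ge> 1" "n = 3"
  shows "f\<mu> k G = 3"
proof (rule ftmv_number_eqI[OF finite_pverts_G])
  \<comment> \<open>A whole row is a triangle when \<open>n = 3\<close>.\<close>
  show "ftmv_set k G ({0} \<times> {..<3})"
  proof (rule ftmv_set_clique)
    show "{0} \<times> {..<3} \<subseteq> pverts G" unfolding pverts_G using m assms(2) by auto
    have "cdist n a b = 1" if "a < 3" "b < 3" "a \<noteq> b" for a b
      using that assms(2) by (auto simp: cdist_def ldist_def)
    then show "D u v = 1" if "u \<in> {0} \<times> {..<3}" "v \<in> {0} \<times> {..<3}" "u \<noteq> v" for u v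
      using that ldist_eq_0[of 0 0] by (cases u; cases v) simp
  qed
  show "card X \<le> 3" if "ftmv_set k G X" for X
    using card_le_triangular[OF that assms] .
qed simp

lemma ftmv_number_even:
  assumes "n \<ge> 4" "even n"
  shows "f\<mu> 1 G = min (2 * m) n"
proof -
  obtain h where h: "n = 2 * h" using assms(2) by blast
  note Y = ftmv_antipodal[OF h min.cobounded1 min.cobounded2]
  have "2 * min m h = min (2 * m) n" using h by (simp add: min_def)
  with Y(2) show ?thesis
    by (intro ftmv_number_eqI[OF finite_pverts_G Y(1)]) (use card_le_even assms in auto)
qed

lemma ftmv_number_odd:
  assumes "n \<ge> 5" "odd n"
  shows "f\<mu> 1 G = max 3 (min m n)"
proof -
  obtain h where h: "n = 2 * h + 1" using assms(2) by (elim oddE)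
  have "\<exists>Y. ftmv_set 1 G Y \<and> card Y = max 3 (min m n)"
  \<comment> \<open>The triple attains the value 3; beyond that the diagonal is the larger
    set.\<close>
  proof (cases "min m n \<le> 3")
    case True
    then show ?thesis using ftmv_odd_triple[OF h] h assms(1)
      by (intro exI[of _ "{(0, 0), (0, 1), (1, h + 1)}"]) auto
  next
    case False
    then show ?thesis using ftmv_diagonal[of "min m n"]
      by (intro exI[of _ "(\<lambda>t. (t, t)) ` {..<min m n}"]) (auto simp: card_image inj_on_def)
  qed
  then obtain Y where Y: "ftmv_set 1 G Y" "card Y = max 3 (min m n)" by blast
  show ?thesis
    by (rule ftmv_number_eqI[OF finite_pverts_G Y]) (use card_le_odd assms in blast)
qed

lemma ftmv_number_large_k:
  assumes "k \<ge> 2" "n \<ge> 4"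
  shows "f\<mu> k G = 2"
proof (rule ftmv_number_eqI[OF finite_pverts_G])
  \<comment> \<open>A single edge has no non-adjacent pair.\<close>
  show "ftmv_set k G {(0, 0), (0, 1)}"
    by (rule ftmv_set_clique) (use m assms(2) in \<open>auto simp: pverts_G cdist_def ldist_def\<close>)
  show "card X \<le> 2" if "ftmv_set k G X" for X
    using card_le_two[OF that assms] .
qed simp

end

theorem theorem6p3:
  fixes m n k :: nat
  assumes "m \<ge> 2" and "n \<ge> 3"
  shows "(k \<ge> 1 \<and> n = 3 \<longrightarrow> f\<mu> k (path_graph m \<box> cycle_graph n) = 3) \<and>
         (k = 1 \<and> n \<ge> 4 \<and> even n \<longrightarrow>
            f\<mu> k (path_graph m \<box> cycle_graph n) = min (2 * m) n) \<and>
         (k = 1 \<and> n \<ge> 5 \<and> odd n \<longrightarrow>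
            f\<mu> k (path_graph m \<box> cycle_graph n) = max 3 (min m n)) \<and>
         (k \<ge> 2 \<and> n \<ge> 4 \<longrightarrow> f\<mu> k (path_graph m \<box> cycle_graph n) = 2)"
proof -
  interpret cylinder m n by unfold_locales (rule assms)+
  show ?thesis
    using ftmv_number_triangular ftmv_number_even ftmv_number_odd ftmv_number_large_k by blast
qed

end
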